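(* The closure (in $\mathbb{R}$) of the set of real Wiener roots of trees contains the interval $(-\infty, -1]$.
   Context: For a connected graph $G$ of order at least $2$, the Wiener polynomial is $W(G;x)=\sum x^{d(u,v)}$, where $d(u,v)$ is the distance between $u$ and $v$ and the sum ranges over all unordered pairs of distinct vertices. A Wiener root of $G$ is a complex root of $W(G;x)$. *)

theory Defs
  imports
    "HOL-Analysis.Analysis"
    "HOL-Computational_Algebra.Polynomial"
    "Graph_Theory.Graph_Theory"
begin

text \<open>
  Finite simple graphs are the structures satisfying \<open>graph\<close>: finite, loop-free,
  symmetric digraphs without multiple arcs, an edge being a pair of opposite arcs.
  In this encoding the closed walk along an arc and back is a \<open>cycle\<close>, so the library
  predicate \<open>tree\<close> is not the undirected notion; the cycles of the undirected
  graph are the ones of length at least 3.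
\<close>

definition graph_tree :: "('a, 'b) pre_digraph \<Rightarrow> bool" where
  "graph_tree G \<longleftrightarrow> graph G \<and> Digraph_Component.connected G \<and>
     \<not> (\<exists>p. pre_digraph.cycle G p \<and> 3 \<le> length p)"

text \<open>
  The value is meaningful only if \<open>v\<close> is reachable from \<open>u\<close>; there it is the
  library's shortest-path distance for unit weights, see \<open>gdist_shortest_path\<close>.
\<close>

definition gdist :: "('a, 'b) pre_digraph \<Rightarrow> 'a \<Rightarrow> 'a \<Rightarrow> nat" where
  "gdist G u v = (LEAST n. \<exists>p. pre_digraph.awalk G u p v \<and> length p = n)"

definition vertex_pairs :: "('a, 'b) pre_digraph \<Rightarrow> 'a set set" where
  "vertex_pairs G = {{u, v} | u v. u \<in> verts G \<and> v \<in> verts G \<and> u \<noteq> v}"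

text \<open>
  The distance as a function of an unordered pair; it is well defined
  on graphs because \<^const>\<open>gdist\<close> is symmetric there, see \<open>pair_dist_doubleton\<close>.
\<close>

definition pair_dist :: "('a, 'b) pre_digraph \<Rightarrow> 'a set \<Rightarrow> nat" where
  "pair_dist G e = (THE d. \<exists>u v. e = {u, v} \<and> d = gdist G u v)"

definition wiener_poly :: "('a, 'b) pre_digraph \<Rightarrow> complex poly" where
  "wiener_poly G = (\<Sum>e\<in>vertex_pairs G. monom 1 (pair_dist G e))"

text \<open>
  On a graph with a single vertex \<^const>\<open>wiener_poly\<close> is the zero polynomial and every number
  would be a root, so uses of \<open>wiener_root\<close> must require at least two vertices.
\<close>

definition wiener_root :: "('a, 'b) pre_digraph \<Rightarrow> complex \<Rightarrow> bool" where
  "wiener_root G z \<longleftrightarrow> poly (wiener_poly G) z = 0"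

lemma gdist_shortest_path:
  assumes "wf_digraph G" "reachable G u v"
  shows "wf_digraph.\<mu> G (\<lambda>_. 1) u v = ereal (real (gdist G u v))"
proof -
  interpret wf_digraph G by fact
  have cost: "awalk_cost (\<lambda>_. 1) p = real (length p)" for p :: "'b list"
    by (induction p) auto
  have "\<exists>n p. awalk u p v \<and> length p = n"
    using assms(2) by (auto simp: reachable_awalk)
  then have "\<exists>p. awalk u p v \<and> length p = gdist G u v"
    unfolding gdist_def by (rule LeastI_ex)
  then obtain p where p: "awalk u p v" "length p = gdist G u v"
    by blast
  have least: "gdist G u v \<le> length q" if "awalk u q v" for q
    unfolding gdist_def using that by (intro Least_le) blast
  have "(INF q\<in>{q. awalk u q v}. ereal (real (length q))) = ereal (real (gdist G u v))"
  proof (rule antisym)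
    show "(INF q\<in>{q. awalk u q v}. ereal (real (length q))) \<le> ereal (real (gdist G u v))"
      using p by (intro INF_lower2[of p]) auto
    show "ereal (real (gdist G u v)) \<le> (INF q\<in>{q. awalk u q v}. ereal (real (length q)))"
      using least by (intro INF_greatest) auto
  qed
  then show ?thesis
    by (simp add: \<mu>_def cost)
qed

lemma graph_awalk_rev:
  assumes "graph G" "pre_digraph.awalk G u p v"
  shows "\<exists>q. pre_digraph.awalk G v q u \<and> length q = length p"
proof -
  interpret graph G by fact
  show ?thesis
    using assms(2)
  proof (induction p arbitrary: u)
    case Nil
    then show ?case
      by (metis awalk_Nil_iff)
  next
    case (Cons e p)
    then have e: "e \<in> arcs G" "tail G e = u" and w: "awalk (head G e) p v"
      by (auto simp: awalk_Cons_iff)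
    obtain q where q: "awalk v q (head G e)" "length q = length p"
      using Cons.IH[OF w] by blast
    have "(tail G e, head G e) \<in> arcs_ends G"
      using e(1) by (auto simp: arcs_ends_def arc_to_ends_def)
    then have "(head G e, tail G e) \<in> arcs_ends G"
      using sym_arcs by (auto simp: symmetric_def dest: symD)
    then obtain f where f: "f \<in> arcs G" "tail G f = head G e" "head G f = u"
      using e(2) by (auto simp: arcs_ends_def arc_to_ends_def)
    have "awalk (head G e) [f] u"
      using f by (auto simp: awalk_Cons_iff awalk_Nil_iff)
    then have "awalk v (q @ [f]) u"
      using q(1) by (metis awalk_appendI)
    then show ?case
      using q(2) by (metis length_append_singleton length_Cons)
  qed
qed

lemma gdist_commute:
  assumes "graph G"
  shows "gdist G u v = gdist G v u"
proof -
  have "(\<exists>p. pre_digraph.awalk G u p v \<and> length p = n) \<longleftrightarrow>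
        (\<exists>p. pre_digraph.awalk G v p u \<and> length p = n)" for n
    using graph_awalk_rev[OF assms] by metis
  then show ?thesis
    by (simp add: gdist_def)
qed

lemma pair_dist_doubleton:
  assumes "graph G"
  shows "pair_dist G {u, v} = gdist G u v"
  unfolding pair_dist_def
proof (rule the_equality)
  fix d assume "\<exists>u' v'. {u, v} = {u', v'} \<and> d = gdist G u' v'"
  then show "d = gdist G u v"
    using gdist_commute[OF assms] by (auto simp: doubleton_eq_iff)
qed blast

end

theory Submission
  imports Defs
begin

text \<open>
  Double stars suffice. If the two centres carry \<open>a\<close> and \<open>b\<close> leaves, the Wiener polynomial
  divided by \<open>x\<close> is \<open>(a + b + 1) + (C(a+1, 2) + C(b+1, 2)) x + a b x\<^sup>2\<close>. For \<open>b \<approx> l a\<close> and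
  \<open>a \<rightarrow> \<infinity>\<close>, dividing by \<open>a\<^sup>2\<close> leaves \<open>x ((1 + l\<^sup>2) / 2 + l x)\<close>, whose nonzero root
  \<open>-(1 + l\<^sup>2) / (2 l)\<close> takes every value in \<open>(-\<infinity>, -1]\<close> as \<open>l > 0\<close> varies. Near a simple root
  of the limit, the intermediate value theorem gives roots of the quadratics.
\<close>

section \<open>Double stars as symmetric digraphs\<close>

text \<open>
  The centres are 0 and 1, the leaves at 0 are \<open>2, \<dots>, a + 1\<close> and those at 1 are
  \<open>a + 2, \<dots>, a + b + 1\<close>. As \<open>hub a 1 = 0\<close>, the edges are exactly the pairs
  \<open>{v, hub a v}\<close> with \<open>v \<ge> 1\<close>.
\<close>

definition hub :: "nat \<Rightarrow> nat \<Rightarrow> nat" where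
  "hub a v = (if v < a + 2 then 0 else 1)"

definition ds_adj :: "nat \<Rightarrow> nat \<Rightarrow> nat \<Rightarrow> nat \<Rightarrow> bool" where
  "ds_adj a b u v \<longleftrightarrow>
     1 \<le> u \<and> u < a + b + 2 \<and> v = hub a u \<or> 1 \<le> v \<and> v < a + b + 2 \<and> u = hub a v"

text \<open>Taking an arc to be the ordered pair of its ends excludes parallel arcs and makes every
  edge a pair of opposite arcs.\<close>

definition double_star :: "nat \<Rightarrow> nat \<Rightarrow> (nat, nat \<times> nat) pre_digraph" where
  "double_star a b =
     \<lparr>verts = {..<a + b + 2}, arcs = {(u, v). ds_adj a b u v}, tail = fst, head = snd\<rparr>"

lemma double_star_simps [simp]:
  "verts (double_star a b) = {..<a + b + 2}"
  "e \<in> arcs (double_star a b) \<longleftrightarrow> ds_adj a b (fst e) (snd e)"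
  "tail (double_star a b) = fst" "head (double_star a b) = snd"
  by (auto simp: double_star_def)

lemma ds_adj_verts: "ds_adj a b u v \<Longrightarrow> u < a + b + 2 \<and> v < a + b + 2"
  by (auto simp: ds_adj_def hub_def)

lemma ds_adj_sym: "ds_adj a b u v \<Longrightarrow> ds_adj a b v u"
  by (auto simp: ds_adj_def)

text \<open>Since \<open>hub\<close> only takes the values 0 and 1, the second disjunct of
  \<open>ds_adj\<close> cannot hold for a leaf \<open>u\<close>.\<close>

lemma ds_adj_leaf: "ds_adj a b u v \<Longrightarrow> 2 \<le> u \<Longrightarrow> v = hub a u"
  by (auto simp: ds_adj_def hub_def split: if_splits)

lemma ds_adj_hub: "1 \<le> u \<Longrightarrow> u < a + b + 2 \<Longrightarrow> ds_adj a b u (hub a u)"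
  by (auto simp: ds_adj_def)

lemma graph_double_star: "graph (double_star a b)"
proof -
  have "finite (arcs (double_star a b))"
    by (rule finite_subset[of _ "{..<a + b + 2} \<times> {..<a + b + 2}"])
       (use ds_adj_verts in force)+
  moreover have "symmetric (double_star a b)"
    unfolding symmetric_conv
  proof
    fix e assume "e \<in> arcs (double_star a b)"
    then show "\<exists>f\<in>arcs (double_star a b).
        tail (double_star a b) e = head (double_star a b) f \<and>
        head (double_star a b) e = tail (double_star a b) f"
      by (intro bexI[of _ "(snd e, fst e)"]) (auto dest: ds_adj_sym)
  qed
  ultimately show ?thesis
    by unfold_locales
       (auto dest: ds_adj_verts simp: arc_to_ends_def prod_eq_iff,
        auto simp: ds_adj_def hub_def split: if_splits)
qed

section \<open>Connectedness and absence of cycles\<close>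

lemma double_star_reachable_0:
  assumes "v < a + b + 2"
  shows "reachable (double_star a b) v 0"
proof -
  interpret graph "double_star a b" by (rule graph_double_star)
  have step: "reachable (double_star a b) u (hub a u)" if "1 \<le> u" "u < a + b + 2" for u
    using ds_adj_hub[OF that] by (intro adj_in_verts reachable_adjI)
      (auto simp: arcs_ends_conv image_iff)
  have "reachable (double_star a b) 0 0"
    by (intro reachable_refl) simp
  moreover have "reachable (double_star a b) 1 0"
    using step[of 1] by (simp add: hub_def)
  ultimately show ?thesis
    using step[of v] assms by (cases "v = 0") (auto simp: hub_def split: if_splits intro: reachable_trans)
qed

lemma connected_double_star: "Digraph_Component.connected (double_star a b)"
proof -
  interpret graph "double_star a b" by (rule graph_double_star)
  have "strongly_connected (double_star a b)"
  proof (rule strongly_connectedI)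
    fix u v assume "u \<in> verts (double_star a b)" "v \<in> verts (double_star a b)"
    then have "reachable (double_star a b) u 0" "reachable (double_star a b) 0 v"
      using double_star_reachable_0 symmetric_reachable[OF sym_arcs] by auto
    then show "reachable (double_star a b) u v"
      by (rule reachable_trans)
  qed auto
  then show ?thesis
    using sym_arcs
    by (simp add: Digraph_Component.connected_def strongly_connected_def reachable_mk_symmetric_eq)
qed

text \<open>
  On a closed walk of length at least 3 the predecessor and the successor of a leaf coincide,
  so the vertices of a cycle would all be among the two centres.
\<close>

lemma double_star_no_cycle:
  assumes "pre_digraph.cycle (double_star a b) p"
  shows "length p < 3"
proof (rule ccontr)
  interpret graph "double_star a b" by (rule graph_double_star)
  assume "\<not> length p < 3"
  then obtain e1 e2 e3 es where p: "p = e1 # e2 # e3 # es"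
    by (metis One_nat_def Suc_1 Suc_le_length_iff not_less numeral_3_eq_3)
  from assms obtain u where w: "awalk u p u" and d: "distinct (tl (awalk_verts u p))"
    by (auto simp: cycle_def)
  have "cas u p u"
    using w by (auto simp: awalk_def)
  then have "tl (awalk_verts u p) = map snd p"
    using p by (subst awalk_verts_conv'[of u p u]) auto
  then have dist: "distinct (snd e1 # snd e2 # snd e3 # map snd es)"
    using d by (simp add: p)
  have adj: "ds_adj a b u (snd e1)" "ds_adj a b (snd e1) (snd e2)" "ds_adj a b (snd e2) (snd e3)"
    and es: "awalk (snd e3) es u"
    using w by (auto simp: p awalk_Cons_iff)
  have ends: "cas w es u \<Longrightarrow> u \<in> set (w # map snd es)" for w
    by (induction es arbitrary: w) auto
  \<comment> \<open>The walk closes at \<open>u\<close>, so \<open>u\<close> is the head of its last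
    arc, which comes after \<open>e1\<close> and \<open>e2\<close>.\<close>
  have last: "u \<in> set (snd e3 # map snd es)"
    by (rule ends) (use es in \<open>simp add: awalk_def\<close>)
  have "snd e1 < 2"
  proof (rule ccontr)
    assume "\<not> snd e1 < 2"
    then have "u = snd e2"
      using ds_adj_leaf[OF adj(2)] ds_adj_leaf[OF ds_adj_sym[OF adj(1)]] by simp
    then show False
      using last dist by auto
  qed
  moreover have "snd e2 < 2"
  proof (rule ccontr)
    assume "\<not> snd e2 < 2"
    then show False
      using ds_adj_leaf[OF adj(3)] ds_adj_leaf[OF ds_adj_sym[OF adj(2)]] dist by simp
  qed
  moreover have "snd e3 < 2"
  proof (rule ccontr)
    assume leaf: "\<not> snd e3 < 2"
    \<comment> \<open>The successor of \<open>snd e3\<close>: if \<open>es\<close> is empty then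
      \<open>snd e3 = u\<close> and the walk wraps around to \<open>snd e1\<close>.\<close>
    obtain v where "ds_adj a b (snd e3) v" "v = snd e1 \<or> v \<in> set (map snd es)"
    proof (cases es)
      case Nil
      then show ?thesis
        using es adj(1) by (intro that[of "snd e1"]) (simp_all add: awalk_Nil_iff)
    next
      case (Cons e4 es')
      then show ?thesis
        using es by (intro that[of "snd e4"]) (auto simp: awalk_Cons_iff)
    qed
    then show False
      using ds_adj_leaf[of a b "snd e3" v] ds_adj_leaf[OF ds_adj_sym[OF adj(3)]] leaf dist by auto
  qed
  ultimately show False
    using dist by auto
qed

lemma graph_tree_double_star: "graph_tree (double_star a b)"
  using graph_double_star connected_double_star double_star_no_cycle
  by (fastforce simp: graph_tree_def)

section \<open>Distances and the Wiener polynomial of a double star\<close>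

lemma gdist_eqI:
  assumes "pre_digraph.awalk G u p v" "length p = n"
    and "\<And>q. pre_digraph.awalk G u q v \<Longrightarrow> n \<le> length q"
  shows "gdist G u v = n"
  unfolding gdist_def using assms by (intro Least_equality) auto

lemma double_star_gdist_1:
  assumes "ds_adj a b u v"
  shows "gdist (double_star a b) u v = 1"
proof -
  interpret graph "double_star a b" by (rule graph_double_star)
  have "u \<noteq> v"
    using assms by (auto simp: ds_adj_def hub_def split: if_splits)
  then show ?thesis
    using assms ds_adj_verts[OF assms]
    by (intro gdist_eqI[of _ _ "[(u, v)]"])
       (auto simp: awalk_simps Suc_le_eq)
qed

lemma double_star_gdist_2:
  assumes "ds_adj a b u w" "ds_adj a b w v" "u \<noteq> v" "\<not> ds_adj a b u v"
  shows "gdist (double_star a b) u v = 2"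
proof -
  interpret graph "double_star a b" by (rule graph_double_star)
  have "2 \<le> length q" if "awalk u q v" for q
  proof (rule ccontr)
    assume "\<not> 2 \<le> length q"
    then consider "q = []" | e where "q = [e]"
      by (cases q; cases "tl q") auto
    then show False
      using that assms by cases (auto simp: awalk_simps)
  qed
  then show ?thesis
    using assms ds_adj_verts[OF assms(2)]
    by (intro gdist_eqI[of _ _ "[(u, w), (w, v)]"]) (auto simp: awalk_simps)
qed

text \<open>The three negative assumptions exclude walks of length 0, 1 and 2 respectively.\<close>

lemma double_star_gdist_3:
  assumes "ds_adj a b u w" "ds_adj a b w w'" "ds_adj a b w' v"
    and "u \<noteq> v" "\<not> ds_adj a b u v" "\<And>x. ds_adj a b u x \<Longrightarrow> \<not> ds_adj a b x v"
  shows "gdist (double_star a b) u v = 3"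
proof -
  interpret graph "double_star a b" by (rule graph_double_star)
  have "3 \<le> length q" if "awalk u q v" for q
  proof (rule ccontr)
    assume "\<not> 3 \<le> length q"
    then consider "q = []" | e where "q = [e]" | e f where "q = [e, f]"
      by (cases q; cases "tl q"; cases "tl (tl q)") auto
    then show False
      using that assms by cases (auto simp: awalk_simps)
  qed
  then show ?thesis
    using assms ds_adj_verts[OF assms(3)]
    by (intro gdist_eqI[of _ _ "[(u, w), (w, w'), (w', v)]"]) (auto simp: awalk_simps)
qed

text \<open>The pairs are sorted by distance: edges \<open>E\<close>, pairs of neighbours of one
  centre (\<open>P\<close> for 0, \<open>Q\<close> for 1) at distance 2, and pairs \<open>X\<close>
  of leaves on opposite sides at distance 3.\<close>

lemma wiener_poly_double_star:
  "poly (wiener_poly (double_star a b)) z =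
     of_nat (a + b + 1) * z + of_nat ((a + 1 choose 2) + (b + 1 choose 2)) * z ^ 2
     + of_nat (a * b) * z ^ 3"
proof -
  let ?G = "double_star a b"
  define A where "A = {2..<a + 2}"
  define B where "B = {a + 2..<a + b + 2}"
  define E where "E = (\<lambda>v. {v, hub a v}) ` {1..<a + b + 2}"
  define P where "P = {e. e \<subseteq> insert 1 A \<and> card e = 2}"
  define Q where "Q = {e. e \<subseteq> insert 0 B \<and> card e = 2}"
  define X where "X = (\<lambda>(u, v). {u, v}) ` (A \<times> B)"
  have pd: "pair_dist ?G {u, v} = gdist ?G u v" for u v
    by (rule pair_dist_doubleton[OF graph_double_star])
  have adj_iff: "ds_adj a b u v \<longleftrightarrow> u = 0 \<and> v \<in> insert 1 A \<or> v = 0 \<and> u \<in> insert 1 A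
      \<or> u = 1 \<and> v \<in> insert 0 B \<or> v = 1 \<and> u \<in> insert 0 B" for u v
    by (auto simp: ds_adj_def hub_def A_def B_def split: if_splits)
  have AB: "0 \<notin> A" "1 \<notin> A" "0 \<notin> B" "1 \<notin> B" "A \<inter> B = {}" "finite A" "finite B"
    "card A = a" "card B = b"
    by (auto simp: A_def B_def)
  have dE: "pair_dist ?G e = 1" if "e \<in> E" for e
    using that double_star_gdist_1[OF ds_adj_hub] by (auto simp: E_def pd)
  have dP: "pair_dist ?G e = 2" if e: "e \<in> P" for e
  proof -
    obtain u v where "e = {u, v}" "u \<noteq> v" "u \<in> insert 1 A" "v \<in> insert 1 A"
      using e unfolding P_def card_2_iff by blast
    then show ?thesis
      using AB by (simp only: pd, intro double_star_gdist_2[of _ _ _ 0]) (auto simp: adj_iff)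
  qed
  have dQ: "pair_dist ?G e = 2" if e: "e \<in> Q" for e
  proof -
    obtain u v where "e = {u, v}" "u \<noteq> v" "u \<in> insert 0 B" "v \<in> insert 0 B"
      using e unfolding Q_def card_2_iff by blast
    then show ?thesis
      using AB by (simp only: pd, intro double_star_gdist_2[of _ _ _ 1]) (auto simp: adj_iff)
  qed
  have dX: "pair_dist ?G e = 3" if e: "e \<in> X" for e
  proof -
    obtain u v where "e = {u, v}" "u \<in> A" "v \<in> B"
      using e by (auto simp: X_def)
    then show ?thesis
      using AB by (simp only: pd, intro double_star_gdist_3[of _ _ _ 0 1]) (auto simp: adj_iff)
  qed
  have fin: "finite E" "finite P" "finite Q" "finite X"
    by (auto simp: E_def P_def Q_def X_def AB)
  have "card E = a + b + 1"
    unfolding E_def by (subst card_image)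
      (auto simp: inj_on_def doubleton_eq_iff hub_def split: if_splits)
  moreover have "card P = a + 1 choose 2" "card Q = b + 1 choose 2"
    using AB by (simp_all add: P_def Q_def n_subsets)
  moreover have "card X = a * b"
    unfolding X_def using AB
    by (subst card_image) (auto simp: inj_on_def doubleton_eq_iff)
  moreover have "E \<inter> P = {}" "E \<inter> Q = {}" "E \<inter> X = {}" "P \<inter> X = {}" "Q \<inter> X = {}"
    using dE dP dQ dX by fastforce+
  \<comment> \<open>Distance does not separate these two classes, but \<open>insert 1 A\<close> and
    \<open>insert 0 B\<close> are disjoint.\<close>
  moreover have "P \<inter> Q = {}"
    using AB by (fastforce simp: P_def Q_def card_2_iff)
  moreover have "vertex_pairs ?G = E \<union> (P \<union> Q) \<union> X"
  proof (intro equalityI subsetI)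
    fix e assume "e \<in> vertex_pairs ?G"
    \<comment> \<open>Ordering the pair puts \<open>A\<close> before \<open>B\<close>, so the only
      case outside \<open>E\<close>, \<open>P\<close> and \<open>Q\<close> is \<open>u\<close> in
      \<open>A\<close>, \<open>v\<close> in \<open>B\<close>.\<close>
    then obtain u v where e: "e = {u, v}" "u < v" "v < a + b + 2"
      by (auto simp: vertex_pairs_def) (metis insert_commute linorder_neqE_nat)
    have V: "u \<in> {0, 1} \<union> A \<union> B" "v \<in> {1} \<union> A \<union> B"
      using e by (auto simp: A_def B_def)
    have adjE: "e \<in> E" if "ds_adj a b u v"
      using that e by (auto simp: ds_adj_def E_def)
    show "e \<in> E \<union> (P \<union> Q) \<union> X"
    proof (cases "ds_adj a b u v \<or> e \<in> P \<or> e \<in> Q")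
      case False
      then have "u \<in> A" "v \<in> B"
        using V e by (auto simp: adj_iff P_def Q_def A_def B_def card_2_iff)
      then show ?thesis
        using e by (auto simp: X_def)
    qed (use adjE in auto)
  next
    fix e assume "e \<in> E \<union> (P \<union> Q) \<union> X"
    moreover have "e \<in> vertex_pairs ?G" if "e \<in> P \<union> Q"
      using that unfolding P_def Q_def vertex_pairs_def A_def B_def by (fastforce simp: card_2_iff)
    moreover have "e \<in> vertex_pairs ?G" if "e \<in> E \<union> X"
      using that by (fastforce simp: E_def X_def A_def B_def vertex_pairs_def hub_def split: if_splits)
    ultimately show "e \<in> vertex_pairs ?G" by blast
  qed
  ultimately show ?thesis
    using fin dE dP dQ dX
    by (simp add: wiener_poly_def sum.union_disjoint Int_Un_distrib Int_Un_distrib2 poly_sum poly_monom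
        algebra_simps)
qed

section \<open>The quadratic factor and its scaling limit\<close>

text \<open>The Wiener polynomial of \<open>double_star a b\<close> divided by \<open>x\<close>, as
  a real function so that the intermediate value theorem applies.\<close>

definition ds_quot :: "nat \<Rightarrow> nat \<Rightarrow> real \<Rightarrow> real" where
  "ds_quot a b x = real (a + b + 1) + real ((a + 1 choose 2) + (b + 1 choose 2)) * x
     + real (a * b) * x ^ 2"

lemma wiener_root_double_star:
  assumes "ds_quot a b x = 0"
  shows "wiener_root (double_star a b) (complex_of_real x)"
proof -
  have "poly (wiener_poly (double_star a b)) (complex_of_real x) = complex_of_real (x * ds_quot a b x)"
    by (simp add: wiener_poly_double_star ds_quot_def algebra_simps power2_eq_square power3_eq_cube
        del: binomial_Suc_Suc)
  then show ?thesis
    by (simp add: wiener_root_def assms)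
qed

lemma real_choose_two: "real (m + 1 choose 2) = real m * (real m + 1) / 2"
  by (induction m) (auto simp: numeral_2_eq_2 field_simps)

text \<open>The constant term grows only linearly in \<open>n\<close> and vanishes in the limit; the
  other two coefficients grow quadratically.\<close>

lemma ds_quot_limit:
  assumes "l > 0"
  shows "(\<lambda>n. ds_quot n (nat \<lfloor>l * real n\<rfloor>) x / real n ^ 2)
           \<longlonglongrightarrow> (1 + l\<^sup>2) / 2 * x + l * x\<^sup>2"
proof -
  \<comment> \<open>The ratio of the leaf numbers; rounding down costs at most
    \<open>1 / real n\<close>.\<close>
  define c where "c n = real (nat \<lfloor>l * real n\<rfloor>) / real n" for n
  have c: "c \<longlonglongrightarrow> l"
  proof (rule tendsto_sandwich)
    show "\<forall>\<^sub>F n in sequentially. l - 1 / real n \<le> c n"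
      using eventually_gt_at_top[of 0]
    proof eventually_elim
      case (elim n)
      have "l * real n - 1 \<le> real (nat \<lfloor>l * real n\<rfloor>)" by linarith
      then have "(l * real n - 1) / real n \<le> c n"
        unfolding c_def by (intro divide_right_mono) auto
      then show ?case using elim by (simp add: diff_divide_distrib)
    qed
    show "\<forall>\<^sub>F n in sequentially. c n \<le> l"
      using eventually_gt_at_top[of 0]
    proof eventually_elim
      case (elim n)
      have "real (nat \<lfloor>l * real n\<rfloor>) \<le> l * real n"
        using assms by (simp add: of_nat_nat)
      then show ?case using elim by (simp add: c_def field_simps)
    qed
    show "(\<lambda>n. l - 1 / real n) \<longlonglongrightarrow> l"
      using tendsto_diff[OF tendsto_const lim_1_over_n] by simp
  qed simp
  note i = lim_1_over_n[where 'a = real]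
  \<comment> \<open>The scaled quadratic rewritten in \<open>c n\<close> and
    \<open>1 / real n\<close>, with \<open>real (m + 1 choose 2)\<close> expanded as
    \<open>m * (m + 1) / 2\<close>.\<close>
  have "(\<lambda>n. (1 / real n + c n * (1 / real n) + (1 / real n)\<^sup>2)
      + ((1 + 1 / real n) / 2 + ((c n)\<^sup>2 + c n * (1 / real n)) / 2) * x + c n * x\<^sup>2)
    \<longlonglongrightarrow> (0 + l * 0 + 0\<^sup>2) + ((1 + 0) / 2 + (l\<^sup>2 + l * 0) / 2) * x + l * x\<^sup>2"
    by (intro tendsto_intros c i) auto
  also have "(0 + l * 0 + 0\<^sup>2) + ((1 + 0) / 2 + (l\<^sup>2 + l * 0) / 2) * x + l * x\<^sup>2
      = (1 + l\<^sup>2) / 2 * x + l * x\<^sup>2"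
    by (simp add: field_simps)
  finally show ?thesis
  proof (rule Lim_transform_eventually)
    show "\<forall>\<^sub>F n in sequentially. (1 / real n + c n * (1 / real n) + (1 / real n)\<^sup>2)
      + ((1 + 1 / real n) / 2 + ((c n)\<^sup>2 + c n * (1 / real n)) / 2) * x + c n * x\<^sup>2
      = ds_quot n (nat \<lfloor>l * real n\<rfloor>) x / real n ^ 2"
      using eventually_gt_at_top[of 0]
    proof eventually_elim
      case (elim n)
      then have "real (nat \<lfloor>l * real n\<rfloor>) = c n * real n"
        by (simp add: c_def)
      then show ?case
        unfolding ds_quot_def of_nat_add[of "_ choose _"] real_choose_two of_nat_add of_nat_mult
        using elim by (simp add: field_simps power2_eq_square)
    qed
  qed
qed

section \<open>Approximating a prescribed real number by roots\<close>

text \<open>For a suitable ratio \<open>l\<close> the limit function has a simple zero at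
  \<open>x\<close>; its sign change there passes to \<open>ds_quot\<close> for large
  \<open>n\<close>.\<close>

lemma ds_quot_root_near:
  assumes "x \<le> -1" "0 < d" "d < 1"
  shows "\<exists>a b y. \<bar>y - x\<bar> \<le> d \<and> ds_quot a b y = 0"
proof -
  \<comment> \<open>a root of \<open>l\<^sup>2 + 2 l x + 1\<close>, so that \<open>x = -(1 + l\<^sup>2) / (2 l)\<close>\<close>
  define l where "l = sqrt (x\<^sup>2 - 1) - x"
  have "1 \<le> x\<^sup>2"
    using assms(1) abs_le_square_iff[of 1 x] by simp
  then have "0 \<le> sqrt (x\<^sup>2 - 1)" and "(sqrt (x\<^sup>2 - 1))\<^sup>2 = x\<^sup>2 - 1"
    by simp_all
  then have "l > 0" and "l\<^sup>2 + 2 * l * x + 1 = 0"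
    using assms(1) unfolding l_def by (linarith, algebra)
  \<comment> \<open>The equation for \<open>l\<close> gives
    \<open>(1 + l^2) / 2 = - l * x\<close>.\<close>
  then have lim: "(1 + l\<^sup>2) / 2 * y + l * y\<^sup>2 = l * y * (y - x)" for y
    by (simp add: field_simps power2_eq_square) algebra
  let ?q = "\<lambda>n. ds_quot n (nat \<lfloor>l * real n\<rfloor>)"
  \<comment> \<open>As \<open>d < 1\<close>, both \<open>x + d\<close> and \<open>x - d\<close> are
    negative, so \<open>l * y * (y - x)\<close> is negative at the first and positive at the
    second.\<close>
  have "\<forall>\<^sub>F n in sequentially. ?q n (x + d) / real n ^ 2 < 0"
    using assms \<open>l > 0\<close>
    by (intro order_tendstoD(2)[OF ds_quot_limit[OF \<open>l > 0\<close>, unfolded lim]])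
       (auto simp: mult_less_0_iff)
  moreover have "\<forall>\<^sub>F n in sequentially. 0 < ?q n (x - d) / real n ^ 2"
    using assms \<open>l > 0\<close>
    by (intro order_tendstoD(1)[OF ds_quot_limit[OF \<open>l > 0\<close>, unfolded lim]])
       (auto simp: zero_less_mult_iff mult_less_0_iff)
  ultimately have "\<forall>\<^sub>F n in sequentially. ?q n (x + d) < 0 \<and> 0 < ?q n (x - d)"
    by eventually_elim (auto simp: divide_less_0_iff zero_less_divide_iff)
  then obtain n where n: "?q n (x + d) < 0" "0 < ?q n (x - d)"
    by (auto simp: eventually_sequentially)
  have "\<exists>y\<ge>x - d. y \<le> x + d \<and> ?q n y = 0"
    using n assms unfolding ds_quot_def
    by (intro IVT2') (auto intro!: continuous_intros)
  then show ?thesis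
    by (metis abs_diff_le_iff)
qed

theorem theorem11:
  shows "{..-1} \<subseteq> closure {x :: real. \<exists>T :: (nat, nat \<times> nat) pre_digraph.
     graph_tree T \<and> 2 \<le> card (verts T) \<and> wiener_root T (complex_of_real x)}"
proof
  fix x :: real assume x: "x \<in> {..-1}"
  show "x \<in> closure {x :: real. \<exists>T :: (nat, nat \<times> nat) pre_digraph.
     graph_tree T \<and> 2 \<le> card (verts T) \<and> wiener_root T (complex_of_real x)}"
    unfolding closure_approachable
  proof (intro allI impI)
    fix e :: real assume "e > 0"
    \<comment> \<open>Strictly below \<open>e\<close>, because the root is only known to satisfy a
      weak bound by \<open>d\<close>, and below 1 as \<open>ds_quot_root_near\<close>
      requires.\<close>
    define d where "d = min (e / 2) (1 / 2)"
    have "0 < d" "d < 1" "d < e"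
      using \<open>e > 0\<close> by (auto simp: d_def)
    then obtain a b y where y: "\<bar>y - x\<bar> \<le> d" "ds_quot a b y = 0"
      using ds_quot_root_near[of x d] x by auto
    then have "dist y x < e"
      using \<open>d < e\<close> by (simp add: dist_real_def)
    moreover have "graph_tree (double_star a b)" "2 \<le> card (verts (double_star a b))"
      "wiener_root (double_star a b) (complex_of_real y)"
      using y(2) by (auto intro: graph_tree_double_star wiener_root_double_star)
    ultimately show "\<exists>y\<in>{x. \<exists>T :: (nat, nat \<times> nat) pre_digraph. graph_tree T \<and>
        2 \<le> card (verts T) \<and> wiener_root T (complex_of_real x)}. dist y x < e"
      by blast
  qed
qed

end
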